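(* Let $\lambda>0$ and let $\mu\in\mathbb{C}$ satisfy $|1-\mu|<\lambda$. If $f\in\mathcal{U}(\lambda,\mu)$ and $$\frac{z}{f(z)}=1+\sum_{k=1}^{\infty}b_kz^k,$$ then for every $k\ge 2$ $$|b_k|\le\frac{\lambda}{k-1}\left(1-\frac{|1-\mu|^2}{\lambda^2}\right).$$ These inequalities are best possible: for every such $\lambda,\mu$ and every $k\ge 2$ there exists $f\in\mathcal{U}(\lambda,\mu)$ for which equality holds in the inequality for $b_k$.
   Context: $\mathbb{D}=\{z\in\mathbb{C}:|z|<1\}$. For $\lambda>0$ and $\mu\in\mathbb{C}$ with $|1-\mu|<\lambda$, $\mathcal{U}(\lambda,\mu)$ denotes the family of all functions $f$ meromorphic in $\mathbb{D}$, normalized by $f(0)=f'(0)-1=0$, such that $|U_f(z)-\mu|<\lambda$ for all $z\in\mathbb{D}$, where $$U_f(z)=\left(\frac{z}{f(z)}\right)^2 f'(z)=\frac{z}{f(z)}-z\left(\frac{z}{f(z)}\right)',$$ understood with removable singularities removed (at $z=0$, where $z/f(z)$ takes the value $1$, and at the poles of $f$, where $z/f(z)$ takes the value $0$). The expansion of $z/f(z)$ is its Taylor expansion about $0$. *)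

theory Defs
  imports "HOL-Complex_Analysis.Complex_Analysis"
begin

(* At a pole of f the function z / f z takes the value 0. *)
definition z_over :: "(complex \<Rightarrow> complex) \<Rightarrow> complex \<Rightarrow> complex" where
  "z_over f = remove_sings (\<lambda>z. z / f z)"

(* On the common domain of regularity, (z / f z)^2 * f' z = z / f z - z * (z / f)' z. *)
definition U_op :: "(complex \<Rightarrow> complex) \<Rightarrow> complex \<Rightarrow> complex" where
  "U_op f = remove_sings (\<lambda>z. (z / f z)\<^sup>2 * deriv f z)"

(* A meromorphic function is represented by its "nice" version: value 0 at poles,
   continuous elsewhere. The derivative condition at 0 also excludes a pole there, which f 0 = 0
   alone would not.
   If f had a zero z0 other than 0 in the disc, the expression in U_op would have a genuine pole
   there; remove_sings assigns 0 at z0 itself, but the bound then fails at points near z0, so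
   such f are excluded from the family. *)
definition U_family :: "real \<Rightarrow> complex \<Rightarrow> (complex \<Rightarrow> complex) set" where
  "U_family lam \<mu> = {f. f nicely_meromorphic_on ball 0 1 \<and> f 0 = 0 \<and>
     (f has_field_derivative 1) (at 0) \<and>
     (\<forall>z\<in>ball 0 1. cmod (U_op f z - \<mu>) < lam)}"

end

theory Submission
  imports Defs
begin

text \<open>If \<open>z / f z\<close> has Taylor coefficients \<open>b\<^sub>k\<close>, then \<open>U_op f\<close> has Taylor coefficients
  \<open>(1 - k) * b\<^sub>k\<close>, so the function \<open>g = (U_op f - \<mu>) / lam\<close>, which maps the unit disc to itself,
  has coefficients \<open>(1 - k) * b\<^sub>k / lam\<close> for \<open>k \<ge> 2\<close> and \<open>g 0 = (1 - \<mu>) / lam\<close>.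
  The bound is thus the classical inequality \<open>\<bar>c\<^sub>k\<bar> \<le> 1 - \<bar>c\<^sub>0\<bar>\<^sup>2\<close> for self-maps of the disc, and its extremal maps
  \<open>(a + z ^ k) / (1 + cnj a * z ^ k)\<close> with \<open>a = g 0\<close> give sharpness.\<close>

section \<open>Taylor coefficients of self-maps of the unit disc\<close>

text \<open>Cauchy's inequality on circles of radius \<open>r < 1\<close>, followed by
  \<open>r\<close> tending to 1, since \<open>g\<close> need not extend to the unit circle.\<close>

lemma norm_fps_nth_le_1:
  assumes hol: "g holomorphic_on ball 0 1"
    and bound: "\<And>z. z \<in> ball 0 1 \<Longrightarrow> norm (g z) \<le> 1"
    and exp: "g has_fps_expansion c"
  shows "norm (fps_nth c n) \<le> 1"
proof -
  have *: "norm (fps_nth c n) * r ^ n \<le> 1" if r: "0 < r" "r < 1" for r :: real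
  proof -
    have "norm ((deriv ^^ n) g 0) \<le> fact n * 1 / r ^ n"
    proof (rule Cauchy_inequality)
      show "g holomorphic_on ball 0 r"
        using hol by (rule holomorphic_on_subset) (use r in auto)
      show "continuous_on (cball 0 r) g"
        using hol by (intro holomorphic_on_imp_continuous_on[OF holomorphic_on_subset]) (use r in auto)
    qed (use r bound in auto)
    then show ?thesis
      using r by (simp add: fps_nth_fps_expansion[OF exp] norm_divide field_simps)
  qed
  have "((\<lambda>r. norm (fps_nth c n) * r ^ n) \<longlongrightarrow> norm (fps_nth c n) * 1 ^ n) (at_left 1)"
    by (intro tendsto_intros)
  moreover have "\<forall>\<^sub>F r in at_left 1. norm (fps_nth c n) * r ^ n \<le> 1"
    using eventually_at_left_real[of 0 1] by (rule eventually_mono) (auto intro: *)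
  ultimately show ?thesis
    using tendsto_upperbound[of _ "norm (fps_nth c n) * 1 ^ n" "at_left (1::real)"]
    by (simp add: trivial_limit_at_left_real)
qed

text \<open>A geometric sum whose ratio differs from 1, as \<open>n\<close> does not divide
  \<open>k\<close>, but has \<open>n\<close>-th power 1.\<close>

lemma sum_powers_root_of_unity:
  fixes n k :: nat
  assumes "0 < k" "k < n"
  shows "(\<Sum>j<n. exp (2 * of_real pi * \<i> / of_nat n) ^ (j * k)) = 0"
proof -
  define \<omega> where "\<omega> = exp (2 * of_real pi * \<i> / of_nat n)"
  have \<omega>: "\<omega> ^ m = exp (2 * of_real pi * \<i> * of_nat m / of_nat n)" for m
    by (simp add: \<omega>_def mult_ac flip: exp_of_nat_mult)
  have "\<omega> ^ k \<noteq> 1"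
    using complex_root_unity_eq_1[of n k] assms by (auto simp: \<omega> dest: dvd_imp_le)
  moreover have "(\<omega> ^ k) ^ n = 1"
  proof -
    have "\<omega> ^ n = 1"
      using assms by (simp add: \<omega>)
    then show ?thesis
      by (metis mult.commute power_mult power_one)
  qed
  ultimately show ?thesis
    using geometric_sum[of "\<omega> ^ k" n]
    by (simp add: \<omega>_def mult.commute flip: power_mult)
qed

text \<open>Compose \<open>h\<close> with the disc automorphism that sends \<open>a = h 0\<close> to
  0. Because of the gap, the \<open>n\<close>-th coefficient of the composition is that of
  \<open>h\<close> divided by \<open>1 - (norm a)\<^sup>2\<close>, and it has norm at most
  1.\<close>

lemma norm_fps_nth_le_of_gap:
  assumes hol: "h holomorphic_on ball 0 1"
    and bound: "\<And>z. z \<in> ball 0 1 \<Longrightarrow> norm (h z) < 1"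
    and exp: "h has_fps_expansion c"
    and gap: "\<And>k. 0 < k \<Longrightarrow> k < n \<Longrightarrow> fps_nth c k = 0"
    and n: "n > 0"
  shows "norm (fps_nth c n) \<le> 1 - (norm (fps_nth c 0))\<^sup>2"
proof -
  define a where "a = fps_nth c 0"
  have "h 0 = a"
    using exp by (simp add: a_def has_fps_expansion_imp_0_eq_fps_nth_0)
  with bound[of 0] have a: "norm a < 1"
    by simp
  then have a2: "(norm a)\<^sup>2 < 1"
    by (simp add: abs_square_less_1)
  have aa: "1 - cnj a * a = of_real (1 - (norm a)\<^sup>2)"
    by (simp add: complex_norm_square mult.commute del: of_real_power)
  define D where "D = 1 - fps_const (cnj a) * c"
  define S where "S = fps_shift n (c - fps_const a)"
  have D0: "fps_nth D 0 = of_real (1 - (norm a)\<^sup>2)"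
    by (simp add: D_def aa flip: a_def)
  then have D0': "fps_nth D 0 \<noteq> 0"
    using a2 by (metis less_irrefl of_real_eq_0_iff right_minus_eq)
  have "Moebius_function 0 a \<circ> h holomorphic_on ball 0 1"
    using bound by (intro holomorphic_on_compose_gen[OF hol Moebius_function_holomorphic[OF a]]) auto
  moreover have "(Moebius_function 0 a \<circ> h) has_fps_expansion (c - fps_const a) / D"
    unfolding o_def Moebius_function_simple D_def
    using D0' by (intro fps_expansion_intros exp) (simp add: D_def)
  moreover have "norm ((Moebius_function 0 a \<circ> h) z) \<le> 1" if "z \<in> ball 0 1" for z
    using Moebius_function_norm_lt_1[OF a bound[OF that], of 0] by simp
  ultimately have le: "norm (fps_nth ((c - fps_const a) / D) n) \<le> 1"
    by (intro norm_fps_nth_le_1) auto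
  \<comment> \<open>The numerator is divisible by \<open>fps_X ^ n\<close>, so only the constant
    term of \<open>D\<close> matters at order \<open>n\<close>.\<close>
  have "c - fps_const a = fps_X ^ n * S"
    using gap by (intro fps_ext) (auto simp: S_def fps_X_power_mult_nth a_def fps_const_def)
  then have "(c - fps_const a) / D = fps_X ^ n * (S * inverse D)"
    using D0' by (simp add: fps_divide_unit mult.assoc)
  then have "fps_nth ((c - fps_const a) / D) n = fps_nth c n / of_real (1 - (norm a)\<^sup>2)"
    using n by (simp only: fps_X_power_mult_nth) (simp add: S_def D0 field_simps del: of_real_diff)
  with le a2 show ?thesis
    by (simp add: norm_divide a_def del: of_real_diff)
qed

text \<open>Averaging over the rotations by \<open>n\<close>-th roots of unity kills the coefficients between
  \<open>0\<close> and \<open>n\<close> and keeps these two.\<close>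

lemma norm_fps_nth_le_bounded:
  assumes hol: "g holomorphic_on ball 0 1"
    and bound: "\<And>z. z \<in> ball 0 1 \<Longrightarrow> norm (g z) < 1"
    and exp: "g has_fps_expansion c"
    and n: "n > 0"
  shows "norm (fps_nth c n) \<le> 1 - (norm (fps_nth c 0))\<^sup>2"
proof -
  define \<omega> where "\<omega> = exp (2 * of_real pi * \<i> / of_nat n)"
  have norm_\<omega>: "norm (\<omega> ^ j) = 1" for j
    by (simp add: \<omega>_def norm_power)
  have \<omega>n: "\<omega> ^ n = 1"
    using n by (simp add: \<omega>_def flip: exp_of_nat_mult)
  define h where "h = (\<lambda>z. inverse (of_nat n) * (\<Sum>j<n. (g \<circ> (\<lambda>z. \<omega> ^ j * z)) z))"
  define d where "d = fps_const (inverse (of_nat n)) *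
    (\<Sum>j<n. fps_compose c (fps_const (\<omega> ^ j) * fps_X))"
  have rot: "\<omega> ^ j * z \<in> ball 0 1" if "z \<in> ball 0 1" for j z
    using that by (simp add: norm_mult norm_\<omega>)
  \<comment> \<open>Rotation by \<open>\<omega> ^ j\<close> multiplies the \<open>k\<close>-th
    coefficient by \<open>\<omega> ^ (j * k)\<close>.\<close>
  have d_nth: "fps_nth d k = inverse (of_nat n) * (\<Sum>j<n. \<omega> ^ (j * k)) * fps_nth c k" for k
    by (simp add: d_def fps_compose_linear fps_sum_nth sum_distrib_right mult.assoc
             flip: power_mult)
  have "norm (fps_nth d n) \<le> 1 - (norm (fps_nth d 0))\<^sup>2"
  proof (rule norm_fps_nth_le_of_gap)
    show "h holomorphic_on ball 0 1"
      unfolding h_def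
      by (intro holomorphic_intros holomorphic_on_compose_gen[OF _ hol]) (use rot in auto)
    show "h has_fps_expansion d"
      unfolding h_def d_def by (intro fps_expansion_intros exp) auto
    show "fps_nth d k = 0" if "0 < k" "k < n" for k
      using sum_powers_root_of_unity[OF that] by (simp add: d_nth \<omega>_def)
    show "norm (h z) < 1" if z: "z \<in> ball 0 1" for z
    proof -
      have "norm (\<Sum>j<n. (g \<circ> (\<lambda>z. \<omega> ^ j * z)) z) \<le> (\<Sum>j<n. norm (g (\<omega> ^ j * z)))"
        by (rule order_trans[OF norm_sum]) simp
      also have "\<dots> < (\<Sum>j<n. 1)"
        using n by (intro sum_strict_mono bound rot[OF z]) auto
      finally show ?thesis
        using n by (simp add: h_def norm_mult norm_inverse norm_divide divide_simps)
    qed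
  qed (rule n)
  \<comment> \<open>At the indices \<open>0\<close> and \<open>n\<close> every
    \<open>\<omega> ^ (j * k)\<close> is 1, so \<open>d\<close> and \<open>c\<close> agree
    there.\<close>
  then show ?thesis
    using n by (simp add: d_nth mult.commute[of _ n] power_mult \<omega>n)
qed


section \<open>Holomorphy and Taylor expansion of \<open>U_op f\<close>\<close>

lemma nicely_meromorphic_on_bounded_imp_holomorphic_on:
  assumes mero: "F nicely_meromorphic_on A" and "open A"
    and bound: "\<And>z. z \<in> A \<Longrightarrow> norm (F z) \<le> B"
  shows "F holomorphic_on A"
proof -
  have "\<not> is_pole F z" if z: "z \<in> A" for z
  proof
    assume "is_pole F z"
    then have "\<forall>\<^sub>F w in at z. norm (F w) > B"
      unfolding is_pole_def by (auto simp: filterlim_at_infinity_conv_norm_at_top filterlim_at_top_dense)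
    moreover have "\<forall>\<^sub>F w in at z. norm (F w) \<le> B"
      using eventually_at_in_open'[OF \<open>open A\<close> z] by (rule eventually_mono) (rule bound)
    ultimately have "\<forall>\<^sub>F w in at z. False"
      by eventually_elim simp
    then show False
      by simp
  qed
  then show ?thesis
    using nicely_meromorphic_without_singularities[OF mero] analytic_imp_holomorphic by blast
qed

text \<open>Meant for \<open>Z = z_over f\<close>, where this combination agrees with
  \<open>U_op f\<close> near 0.\<close>

lemma has_fps_expansion_minus_times_deriv:
  fixes Z :: "complex \<Rightarrow> complex"
  assumes "Z has_fps_expansion b"
  shows "(\<lambda>z. Z z - z * deriv Z z) has_fps_expansion Abs_fps (\<lambda>k. (1 - of_nat k) * fps_nth b k)"
proof -
  have "(\<lambda>z. Z z - z * deriv Z z) has_fps_expansion b - fps_X * fps_deriv b"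
    by (intro fps_expansion_intros assms)
  also have "b - fps_X * fps_deriv b = Abs_fps (\<lambda>k. (1 - of_nat k) * fps_nth b k)"
    by (rule fps_ext) (auto simp: algebra_simps)
  finally show ?thesis .
qed

text \<open>Membership in the family bounds \<open>U_op f\<close> on the disc, so no pole can
  survive there.\<close>

lemma U_op_holomorphic:
  assumes f: "f \<in> U_family lam \<mu>"
  shows "U_op f holomorphic_on ball 0 1"
proof -
  have "f meromorphic_on ball 0 1"
    using f by (simp add: U_family_def nicely_meromorphic_on_def)
  then have "U_op f nicely_meromorphic_on ball 0 1"
    unfolding U_op_def by (intro remove_sings_nicely_meromorphic meromorphic_intros)
  moreover have "norm (U_op f z) \<le> lam + norm \<mu>" if "z \<in> ball 0 1" for z
    using f that norm_triangle_ineq2[of "U_op f z" \<mu>] by (force simp: U_family_def)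
  ultimately show ?thesis
    by (intro nicely_meromorphic_on_bounded_imp_holomorphic_on) auto
qed

text \<open>Near 0 but off 0, \<open>f\<close> is analytic and nonzero, so the quotient rule
  identifies \<open>U_op f\<close> with \<open>z_over f z - z * deriv (z_over f) z\<close>.
  Continuity of both sides extends this to 0 itself.\<close>

lemma U_op_has_fps_expansion:
  assumes f: "f \<in> U_family lam \<mu>" and b: "z_over f has_fps_expansion b"
  shows "U_op f has_fps_expansion Abs_fps (\<lambda>k. (1 - of_nat k) * fps_nth b k)"
    and "fps_nth b 0 = 1"
proof -
  have mero: "f nicely_meromorphic_on ball 0 1" and f0: "f 0 = 0"
    and f': "(f has_field_derivative 1) (at 0)"
    using f by (auto simp: U_family_def)
  have "f \<midarrow>0\<rightarrow> f 0"
    using DERIV_isCont[OF f'] by (simp add: isCont_def)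
  then have "\<not> is_pole f 0"
    unfolding is_pole_def using not_tendsto_and_filterlim_at_infinity[OF at_neq_bot] by blast
  then have "f analytic_on {0}"
    by (intro nicely_meromorphic_on_imp_analytic_at[OF mero]) auto
  then obtain A where A: "open A" "0 \<in> A" "f holomorphic_on A"
    by (auto simp: analytic_at)
  have quot: "(\<lambda>z. f z / z) \<midarrow>0\<rightarrow> 1"
    using f' f0 by (simp add: has_field_derivative_iff)
  have good: "\<forall>\<^sub>F z in at 0. f analytic_on {z} \<and> f z \<noteq> 0"
    using eventually_at_in_open'[OF A(1,2)] tendsto_imp_eventually_ne[OF quot one_neq_zero]
    by eventually_elim (use A in \<open>auto simp: analytic_at\<close>)
  \<comment> \<open>At such points both expressions under \<open>remove_sings\<close> are analytic,
    so it leaves their values unchanged.\<close>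
  have good': "z_over f z = z / f z"
    "U_op f z = z_over f z - z * deriv (z_over f) z"
    if z: "f analytic_on {z}" "f z \<noteq> 0" for z
  proof -
    have q: "(\<lambda>w. w / f w) analytic_on {z}"
      using z by (intro analytic_intros) auto
    show eq: "z_over f z = z / f z"
      using q by (simp add: z_over_def)
    have "(f has_field_derivative deriv f z) (at z)"
      using z by (intro analytic_derivI)
    then have "((\<lambda>w. w / f w) has_field_derivative (1 * f z - z * deriv f z) / (f z * f z)) (at z)"
      by (intro DERIV_divide DERIV_ident z(2))
    from DERIV_imp_deriv[OF this] have d: "deriv (z_over f) z = (f z - z * deriv f z) / (f z * f z)"
      using q by (simp add: z_over_def)
    have "(\<lambda>w. (w / f w)\<^sup>2 * deriv f w) analytic_on {z}"
      using z by (intro analytic_intros) auto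
    then have "U_op f z = (z / f z)\<^sup>2 * deriv f z"
      by (simp add: U_op_def)
    also have "\<dots> = z_over f z - z * deriv (z_over f) z"
      unfolding d eq using z(2) by (simp add: field_simps power2_eq_square)
    finally show "U_op f z = z_over f z - z * deriv (z_over f) z" .
  qed
  \<comment> \<open>The quotient \<open>z / f z\<close> at 0 is \<open>0 / 0\<close>, hence 0 by
    convention; the true constant coefficient comes from the limit.\<close>
  have "(\<lambda>z. inverse (f z / z)) \<midarrow>0\<rightarrow> inverse 1"
    by (intro tendsto_inverse quot) simp
  moreover have "\<forall>\<^sub>F z in at 0. inverse (f z / z) = z_over f z"
    using good by eventually_elim (simp add: good')
  ultimately have "z_over f \<midarrow>0\<rightarrow> 1"
    by (simp add: tendsto_cong)
  moreover have "z_over f \<midarrow>0\<rightarrow> fps_nth b 0"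
    using has_fps_expansion_imp_tendsto_0[OF b] by (simp add: tendsto_nhds_iff)
  ultimately show "fps_nth b 0 = 1"
    using tendsto_unique[OF at_neq_bot] by blast
  let ?V = "\<lambda>z. z_over f z - z * deriv (z_over f) z"
  have V: "?V has_fps_expansion Abs_fps (\<lambda>k. (1 - of_nat k) * fps_nth b k)"
    by (rule has_fps_expansion_minus_times_deriv[OF b])
  have ev: "\<forall>\<^sub>F z in at 0. U_op f z = ?V z"
    using good by eventually_elim (use good' in blast)
  \<comment> \<open>An expansion at 0 needs agreement on a full neighbourhood, so the value at 0 is
    compared through limits.\<close>
  have "isCont (U_op f) 0"
    using U_op_holomorphic[OF f]
    by (meson centre_in_ball continuous_on_eq_continuous_at holomorphic_on_imp_continuous_on
          open_ball zero_less_one)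
  then have "?V \<midarrow>0\<rightarrow> U_op f 0"
    using tendsto_cong[OF ev] by (simp add: isCont_def)
  moreover have "?V \<midarrow>0\<rightarrow> ?V 0"
    using has_fps_expansion_imp_continuous[OF V, of UNIV] by (simp only: isCont_def)
  ultimately have "U_op f 0 = ?V 0"
    using tendsto_unique[OF at_neq_bot] by blast
  with ev have "\<forall>\<^sub>F z in nhds 0. U_op f z = ?V z"
    by (simp add: eventually_nhds_conv_at)
  from V has_fps_expansion_cong[OF this refl]
  show "U_op f has_fps_expansion Abs_fps (\<lambda>k. (1 - of_nat k) * fps_nth b k)"
    by simp
qed

section \<open>The coefficient estimate\<close>

lemma U_family_coeff_bound:
  assumes f: "f \<in> U_family lam \<mu>" and b: "z_over f has_fps_expansion b" and k: "k \<ge> 2"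
    and lam: "lam > 0"
  shows "norm (fps_nth b k) \<le> lam / (real k - 1) * (1 - (norm (1 - \<mu>))\<^sup>2 / lam\<^sup>2)"
proof -
  define B where "B = Abs_fps (\<lambda>k. (1 - of_nat k) * fps_nth b k)"
  define g where "g = (\<lambda>z. (U_op f z - \<mu>) * inverse (of_real lam))"
  define c where "c = (B - fps_const \<mu>) * fps_const (inverse (of_real lam))"
  note U = U_op_has_fps_expansion[OF f b, folded B_def]
  have "norm (fps_nth c k) \<le> 1 - (norm (fps_nth c 0))\<^sup>2"
  proof (rule norm_fps_nth_le_bounded)
    show "g holomorphic_on ball 0 1"
      unfolding g_def by (intro holomorphic_intros U_op_holomorphic[OF f])
    show "g has_fps_expansion c"
      unfolding g_def c_def by (intro fps_expansion_intros U)
    show "norm (g z) < 1" if "z \<in> ball 0 1" for z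
      using f that lam by (simp add: U_family_def g_def norm_mult norm_inverse norm_divide divide_simps)
  qed (use k in auto)
  moreover have "norm (fps_nth c k) = (real k - 1) * norm (fps_nth b k) / lam"
  proof -
    have "norm (1 - of_nat k :: complex) = norm (of_real (1 - real k) :: complex)"
      by simp
    also have "\<dots> = real k - 1"
      using k by (simp only: norm_of_real)
    finally show ?thesis
      using k lam by (simp add: c_def B_def norm_mult norm_divide norm_inverse divide_inverse)
  qed
  \<comment> \<open>Here \<open>fps_nth b 0 = 1\<close> enters: the constant coefficient of
    \<open>U_op f - \<mu>\<close> is \<open>1 - \<mu>\<close>.\<close>
  moreover have "norm (fps_nth c 0) = norm (1 - \<mu>) / lam"
    using U(2) lam by (simp add: c_def B_def norm_mult norm_divide norm_inverse divide_inverse)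
  ultimately show ?thesis
    using k lam by (simp add: power_divide field_simps)
qed

section \<open>Construction of extremal functions\<close>

text \<open>With \<open>Q' = q\<close>, the function \<open>Z z = 1 - z * Q z\<close> satisfies
  \<open>Z z - z * Z' z = 1 + z\<^sup>2 * q z\<close>; so take \<open>f z = z / Z z\<close>.\<close>

lemma exists_U_op_eq:
  assumes q: "q holomorphic_on ball 0 1"
  obtains f where "f nicely_meromorphic_on ball 0 1" "f 0 = 0"
    "(f has_field_derivative 1) (at 0)" "z_over f analytic_on {0}"
    "\<And>z. z \<in> ball 0 1 \<Longrightarrow> U_op f z = 1 + z\<^sup>2 * q z"
proof -
  \<comment> \<open>The additive constant of \<open>Q\<close> is left free: it only affects the
    linear coefficient of \<open>Z\<close>, which \<open>Z z - z * Z' z\<close> annihilates.\<close>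
  obtain Q where "\<And>z. z \<in> ball 0 1 \<Longrightarrow> (Q has_field_derivative q z) (at z within ball 0 1)"
    using holomorphic_convex_primitive'[OF convex_ball open_ball q] by blast
  then have Q: "(Q has_field_derivative q z) (at z)" if "z \<in> ball 0 1" for z
    using that by (metis at_within_open open_ball)
  define Z where "Z = (\<lambda>z. 1 - z * Q z)"
  define f where "f = (\<lambda>z. z / Z z)"
  have Z': "(Z has_field_derivative - (Q z + z * q z)) (at z)" if "z \<in> ball 0 1" for z
    unfolding Z_def by (rule derivative_eq_intros Q that refl | simp)+
  then have Z_hol: "Z holomorphic_on ball 0 1"
    by (subst holomorphic_on_open) blast+
  have Z_cont: "isCont Z z" if "z \<in> ball 0 1" for z
    using DERIV_isCont[OF Z'[OF that]] .
  have Z0: "Z 0 = 1"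
    by (simp add: Z_def)
  \<comment> \<open>Zeros of \<open>Z\<close> are isolated, because \<open>Z 0 = 1\<close> rules out
    the zero function.\<close>
  have nz: "\<forall>\<^sub>F w in at z. Z w \<noteq> 0 \<and> w \<in> ball 0 1" if "z \<in> ball 0 1" for z
    using non_zero_neighbour_alt[OF Z_hol open_ball connected_ball that, of 0] Z0 by simp
  have f_merom: "f meromorphic_on ball 0 1"
    unfolding f_def
    by (intro meromorphic_intros analytic_on_imp_meromorphic_on) (simp add: analytic_on_open Z_hol)
  \<comment> \<open>At a zero of \<open>Z\<close>, division by zero gives \<open>f z = 0\<close>,
    exactly the value that a nicely meromorphic function takes at a pole.\<close>
  have "is_pole f z \<and> f z = 0 \<or> f \<midarrow>z\<rightarrow> f z" if z: "z \<in> ball 0 1" for z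
  proof (cases "Z z = 0")
    case False
    then show ?thesis
      using Z_cont[OF z] unfolding f_def isCont_def by (auto intro!: tendsto_intros)
  next
    case True
    then have "z \<noteq> 0"
      using Z0 by auto
    moreover have "filterlim Z (at 0) (at z)"
      using Z_cont[OF z] True nz[OF z] by (auto simp: filterlim_at isCont_def elim: eventually_mono)
    ultimately have "is_pole f z"
      unfolding f_def by (intro is_pole_divide) auto
    with True show ?thesis
      by (simp add: f_def)
  qed
  with f_merom have "f nicely_meromorphic_on ball 0 1"
    by (simp add: nicely_meromorphic_on_def)
  moreover have "f 0 = 0"
    by (simp add: f_def)
  moreover have "(f has_field_derivative 1) (at 0)"
    using DERIV_divide[OF DERIV_ident Z'[of 0]] Z0 by (simp add: f_def)
  moreover have "z_over f analytic_on {0}"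
  proof -
    \<comment> \<open>Only \<open>w \<noteq> 0\<close> is needed: if \<open>Z w = 0\<close>, then
      \<open>f w = 0\<close> and both sides are 0 by the convention on division.\<close>
    have "\<forall>\<^sub>F w in at z. w / f w = Z w" for z
      using eventually_neq_at_within[of 0] by eventually_elim (simp add: f_def)
    then have "z_over f = remove_sings Z"
      unfolding z_over_def by (intro ext remove_sings_cong refl)
    moreover have "Z analytic_on {0}"
      using Z_hol by (auto simp: analytic_at intro!: exI[of _ "ball 0 1"])
    ultimately show ?thesis
      using remove_sings_analytic_on by simp
  qed
  moreover have "U_op f z = 1 + z\<^sup>2 * q z" if z: "z \<in> ball 0 1" for z
  proof -
    have "\<forall>\<^sub>F w in at z. (w / f w)\<^sup>2 * deriv f w = 1 + w\<^sup>2 * q w"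
      using nz[OF z] eventually_neq_at_within[of 0]
    proof eventually_elim
      case (elim w)
      then have "(f has_field_derivative (1 * Z w - w * - (Q w + w * q w)) / (Z w * Z w)) (at w)"
        unfolding f_def by (intro DERIV_divide DERIV_ident Z') auto
      from DERIV_imp_deriv[OF this]
      have "deriv f w = (Z w + w * (Q w + w * q w)) / (Z w * Z w)"
        by (simp add: algebra_simps)
      moreover have "Z w + w * (Q w + w * q w) = 1 + w\<^sup>2 * q w"
        by (simp add: Z_def algebra_simps power2_eq_square)
      ultimately show ?case
        using elim by (simp add: f_def power2_eq_square)
    qed
    then have "U_op f z = remove_sings (\<lambda>w. 1 + w\<^sup>2 * q w) z"
      unfolding U_op_def by (intro remove_sings_cong refl)
    moreover have "(\<lambda>w. 1 + w\<^sup>2 * q w) analytic_on {z}"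
      using holomorphic_on_imp_analytic_at[OF q open_ball z] by (intro analytic_intros)
    ultimately show ?thesis
      by simp
  qed
  ultimately show ?thesis
    by (rule that)
qed

text \<open>The extremal map prescribes
  \<open>U_op f = \<mu> + lam * (a + z ^ k) / (1 + cnj a * z ^ k)\<close>. This is 1 at the origin
  and, as \<open>k \<ge> 2\<close>, has no linear term, so it has the form
  \<open>1 + z\<^sup>2 * q z\<close> realised by \<open>exists_U_op_eq\<close>.\<close>

lemma U_family_extremal:
  fixes lam :: real and \<mu> :: complex
  assumes lam: "lam > 0" "norm (1 - \<mu>) < lam" and k: "k \<ge> 2"
  obtains f b where "f \<in> U_family lam \<mu>" "z_over f has_fps_expansion b"
    "norm (fps_nth b k) = lam / (real k - 1) * (1 - (norm (1 - \<mu>))\<^sup>2 / lam\<^sup>2)"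
proof -
  define a where "a = (1 - \<mu>) / of_real lam"
  have norm_a: "norm a = norm (1 - \<mu>) / lam"
    using lam by (simp add: a_def norm_divide)
  then have a: "norm a < 1"
    using lam by simp
  \<comment> \<open>From \<open>(a + w) / (1 + cnj a * w) = a + (1 - cnj a * a) * w / (1 + cnj a *
    w)\<close>, scaled by \<open>lam\<close>.\<close>
  define C :: complex where "C = of_real lam * (1 - cnj a * a)"
  have norm_C: "norm C = lam * (1 - (norm (1 - \<mu>))\<^sup>2 / lam\<^sup>2)"
  proof -
    have "C = of_real (lam * (1 - (norm a)\<^sup>2))"
      by (simp add: C_def complex_norm_square mult.commute del: of_real_power)
    moreover have "(norm a)\<^sup>2 < 1"
      using a by (simp add: abs_square_less_1)
    ultimately have "norm C = lam * (1 - (norm a)\<^sup>2)"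
      using lam by (simp only: norm_of_real) simp
    then show ?thesis
      by (simp add: norm_a power_divide)
  qed
  have zk: "norm (z ^ k) < 1" if "z \<in> ball 0 1" for z :: complex
    using that k by (simp add: norm_power power_less_one_iff)
  have den: "1 + cnj a * z ^ k \<noteq> 0" if "z \<in> ball 0 1" for z
  proof
    assume "1 + cnj a * z ^ k = 0"
    then have "cnj a * z ^ k = -1"
      by (simp add: add_eq_0_iff)
    then have "norm a * norm (z ^ k) = 1"
      by (metis complex_mod_cnj norm_minus_cancel norm_mult norm_one)
    moreover have "norm a * norm (z ^ k) \<le> norm a * 1"
      using zk[OF that] by (intro mult_left_mono) auto
    ultimately show False
      using a by simp
  qed
  \<comment> \<open>The exponent is \<open>k - 2\<close> because the construction supplies the
    factor \<open>z\<^sup>2\<close>.\<close>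
  define q where "q = (\<lambda>z. z ^ (k - 2) * (C / (1 + cnj a * z ^ k)))"
  have "q holomorphic_on ball 0 1"
    unfolding q_def by (intro holomorphic_intros den)
  then obtain f where f: "f nicely_meromorphic_on ball 0 1" "f 0 = 0"
    "(f has_field_derivative 1) (at 0)" "z_over f analytic_on {0}"
    and U: "\<And>z. z \<in> ball 0 1 \<Longrightarrow> U_op f z = 1 + z\<^sup>2 * q z"
    using exists_U_op_eq by metis
  have zq: "z\<^sup>2 * q z = z ^ k * (C / (1 + cnj a * z ^ k))" for z
  proof -
    have "z\<^sup>2 * z ^ (k - 2) = z ^ k"
      using k by (metis le_add_diff_inverse power_add)
    then show ?thesis
      by (simp add: q_def flip: mult.assoc)
  qed
  have "U_op f z - \<mu> = of_real lam * Moebius_function 0 (- a) (z ^ k)" if z: "z \<in> ball 0 1" for z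
  proof -
    have mu: "\<mu> = 1 - of_real lam * a"
      using lam by (simp add: a_def)
    show ?thesis
      unfolding U[OF z] zq Moebius_function_simple C_def mu
      using den[OF z] by (simp add: field_simps)
  qed
  moreover have "norm (Moebius_function 0 (- a) (z ^ k)) < 1" if "z \<in> ball 0 1" for z
    using a zk[OF that] by (intro Moebius_function_norm_lt_1) auto
  ultimately have fU: "f \<in> U_family lam \<mu>"
    using f lam by (simp add: U_family_def norm_mult)
  obtain b where b: "z_over f has_fps_expansion b"
    using analytic_at_imp_has_fps_expansion_0[OF f(4)] by blast
  define D where "D = 1 + fps_const (cnj a) * fps_X ^ k"
  have D0: "fps_nth D 0 = 1"
    using k by (simp add: D_def)
  have "(\<lambda>z. 1 + z ^ k * (C / (1 + cnj a * z ^ k))) has_fps_expansion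
      1 + fps_X ^ k * (fps_const C / D)"
    unfolding D_def using D0 k by (intro fps_expansion_intros) (simp add: D_def)
  moreover have "\<forall>\<^sub>F z in nhds 0. U_op f z = 1 + z ^ k * (C / (1 + cnj a * z ^ k))"
    using eventually_nhds_in_open[OF open_ball, of 0 0 1]
    by (rule eventually_mono) (auto simp: U zq)
  moreover note has_fps_expansion_cong[OF this refl]
  ultimately have "U_op f has_fps_expansion 1 + fps_X ^ k * (fps_const C / D)"
    by simp
  with U_op_has_fps_expansion(1)[OF fU b]
  have "Abs_fps (\<lambda>k. (1 - of_nat k) * fps_nth b k) = 1 + fps_X ^ k * (fps_const C / D)"
    by (rule fps_expansion_unique_complex)
  \<comment> \<open>Compare coefficients at \<open>k\<close>: the summand 1 does not contribute
    since \<open>k > 0\<close>, and \<open>D\<close> has constant term 1, which leaves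
    \<open>C\<close>.\<close>
  from arg_cong[OF this, of "\<lambda>F. fps_nth F k"]
  have "(1 - of_nat k) * fps_nth b k = fps_nth (fps_const C / D) 0"
    using k by (simp add: fps_X_power_mult_nth)
  also have "\<dots> = C"
    using D0 by (simp add: fps_divide_unit)
  finally have bk: "of_real (1 - real k) * fps_nth b k = C"
    by simp
  have "(real k - 1) * norm (fps_nth b k) = norm C"
    unfolding bk[symmetric] norm_mult norm_of_real using k by simp
  then have "norm (fps_nth b k) = lam / (real k - 1) * (1 - (norm (1 - \<mu>))\<^sup>2 / lam\<^sup>2)"
    using k by (simp add: norm_C field_simps)
  with fU b show ?thesis
    by (rule that)
qed

theorem theorem3:
  fixes lam :: real and \<mu> :: complex
  assumes "lam > 0" and "cmod (1 - \<mu>) < lam"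
  shows "(\<forall>f\<in>U_family lam \<mu>. \<forall>b. z_over f has_fps_expansion b \<longrightarrow>
            (\<forall>k\<ge>2. cmod (fps_nth b k)
               \<le> lam / (real k - 1) * (1 - (cmod (1 - \<mu>))\<^sup>2 / lam\<^sup>2))) \<and>
         (\<forall>k\<ge>2. \<exists>f\<in>U_family lam \<mu>. \<exists>b. z_over f has_fps_expansion b \<and>
            cmod (fps_nth b k)
               = lam / (real k - 1) * (1 - (cmod (1 - \<mu>))\<^sup>2 / lam\<^sup>2))"
  using assms by (meson U_family_coeff_bound U_family_extremal)

end
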